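(* Let $k\ge2$. There exist natural numbers $q_{n,j}$ ($n\ge1$, $1\le j\le k$) with $q_{1,1}<\cdots<q_{1,k}<q_{2,1}<\cdots<q_{2,k}<q_{3,1}<\cdots$, $q_{n,j}\mid q_{n,j+1}$ for $1\le j\le k-1$, $q_{n,k}\mid q_{n+1,1}$ for all $n$, and $\lim_{n\to\infty}b_{n+1}/b_n=\infty$ where $b_{(n-1)k+j}=\log q_{n,j}$, such that the numbers $\zeta_j=\sum_{n\ge1}1/q_{n,j}$ ($1\le j\le k$) together with $1$ are linearly independent over $\mathbb{Q}$ and satisfy $\underline\psi_1=-1$ and $\underline\psi_{j+1}=\overline\psi_j$ for $1\le j\le k$; consequently $$\underline\psi_1=-1,\quad \overline\psi_1=\underline\psi_2=\frac{1-k}{2k},\quad \overline\psi_j=\underline\psi_{j+1}=\frac1k\ (2\le j\le k),\quad \overline\psi_{k+1}=\frac1k.$$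
   Context: For $Q>1$ and $1\le j\le k+1$, $\psi_j(Q)$ is the minimum of all real $\theta$ such that the system $|x|\le Q^{1+\theta}$, $|\zeta_ix-y_i|\le Q^{-1/k+\theta}$ ($1\le i\le k$) has $j$ linearly independent solutions $(x,y_1,\dots,y_k)\in\mathbb{Z}^{k+1}$. Set $\underline\psi_j=\liminf_{Q\to\infty}\psi_j(Q)$ and $\overline\psi_j=\limsup_{Q\to\infty}\psi_j(Q)$. *)

theory Defs
  imports "HOL-Analysis.Analysis" "HOL-Library.Extended_Real" "HOL-Library.Liminf_Limsup"
begin

text \<open>Integer vectors in Z^(k+1) are functions nat => int supported on {0..k};
  component 0 is x, component i (1 <= i <= k) is y_i. The reals zeta_1..zeta_k are
  given by a function zeta :: nat => real (indices 1..k).\<close>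

definition int_vec :: "nat \<Rightarrow> (nat \<Rightarrow> int) \<Rightarrow> bool" where
  "int_vec k v \<longleftrightarrow> (\<forall>i>k. v i = 0)"

text \<open>Linear independence (over R, equivalently over Q, for integer vectors) of a finite set.\<close>
definition lin_indep_vecs :: "nat \<Rightarrow> (nat \<Rightarrow> int) set \<Rightarrow> bool" where
  "lin_indep_vecs k S \<longleftrightarrow> finite S \<and> (\<forall>c::(nat \<Rightarrow> int) \<Rightarrow> real.
     (\<forall>i\<le>k. (\<Sum>v\<in>S. c v * real_of_int (v i)) = 0) \<longrightarrow> (\<forall>v\<in>S. c v = 0))"

definition sol_set :: "nat \<Rightarrow> (nat \<Rightarrow> real) \<Rightarrow> real \<Rightarrow> real \<Rightarrow> (nat \<Rightarrow> int) set" where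
  "sol_set k zeta Q \<theta> = {v. int_vec k v \<and>
      \<bar>real_of_int (v 0)\<bar> \<le> Q powr (1 + \<theta>) \<and>
      (\<forall>i\<in>{1..k}. \<bar>zeta i * real_of_int (v 0) - real_of_int (v i)\<bar> \<le> Q powr (\<theta> - 1 / real k))}"

definition psi :: "nat \<Rightarrow> (nat \<Rightarrow> real) \<Rightarrow> nat \<Rightarrow> real \<Rightarrow> real" where
  "psi k zeta j Q = Inf {\<theta>. \<exists>S. S \<subseteq> sol_set k zeta Q \<theta> \<and> card S = j \<and> lin_indep_vecs k S}"

definition psi_lower :: "nat \<Rightarrow> (nat \<Rightarrow> real) \<Rightarrow> nat \<Rightarrow> ereal" where
  "psi_lower k zeta j = Liminf at_top (\<lambda>Q. ereal (psi k zeta j Q))"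

definition psi_upper :: "nat \<Rightarrow> (nat \<Rightarrow> real) \<Rightarrow> nat \<Rightarrow> ereal" where
  "psi_upper k zeta j = Limsup at_top (\<lambda>Q. ereal (psi k zeta j Q))"

end

theory Submission
  imports Defs
begin

text \<open>Take \<open>q\<^sub>l = 2 ^ l!\<close>, distributed cyclically over the \<open>k\<close> series. Truncating the series after
  \<open>q\<^sub>m\<close> gives an integer vector with first entry \<open>q\<^sub>m\<close> and error about \<open>q\<^sub>m / q\<^sub>m\<^sub>+\<^sub>1\<close>. When \<open>ln Q\<close> lies between
  the multiples by \<open>k / (k + 1)\<close> of \<open>ln q\<^sub>m\<^sub>+\<^sub>1\<close> and \<open>ln q\<^sub>m\<^sub>+\<^sub>2\<close>, two consecutive such vectors have exponents
  nearly \<open>1 / k - t\<close> and \<open>t - 1\<close>, where \<open>t = ln q\<^sub>m\<^sub>+\<^sub>1 / ln Q\<close>. The sum \<open>1 / k - 1\<close> of these exponents is as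
  small as it can be, since a nonzero integral minor has absolute value at least 1. The same minors show
  that these are the first two minima up to \<open>o(1)\<close> and that all further minima are \<open>1 / k + o(1)\<close>.
  The extreme values occur at \<open>t = 1 + 1 / k\<close> and \<open>t = (1 + 1 / k) / 2\<close>. An integral relation between 1
  and the series, multiplied by \<open>q\<^sub>m\<close>, makes a combination of the tails a small integer, hence zero for
  all large \<open>m\<close>; comparing consecutive \<open>m\<close> isolates each coefficient.\<close>

section \<open>Solution sets, linear independence and nonvanishing minors\<close>

lemma sol_set_mono:
  assumes "Q \<ge> 1" "\<theta> \<le> \<eta>"
  shows "sol_set k zeta Q \<theta> \<subseteq> sol_set k zeta Q \<eta>"
proof -
  have "Q powr (1 + \<theta>) \<le> Q powr (1 + \<eta>)" "Q powr (\<theta> - 1 / real k) \<le> Q powr (\<eta> - 1 / real k)"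
    using assms by (auto intro!: powr_mono)
  then show ?thesis
    unfolding sol_set_def by (auto intro: order_trans)
qed

lemma lin_indep_vecs_subset:
  assumes "lin_indep_vecs k S" "T \<subseteq> S"
  shows "lin_indep_vecs k T"
  unfolding lin_indep_vecs_def
proof (intro conjI allI impI)
  have fin: "finite S"
    using assms(1) by (simp add: lin_indep_vecs_def)
  then show "finite T"
    using assms(2) finite_subset by blast
  fix c :: "(nat \<Rightarrow> int) \<Rightarrow> real"
  assume c: "\<forall>i\<le>k. (\<Sum>v\<in>T. c v * real_of_int (v i)) = 0"
  let ?d = "\<lambda>v. if v \<in> T then c v else 0"
  have "(\<Sum>v\<in>S. ?d v * real_of_int (v i)) = (\<Sum>v\<in>T. c v * real_of_int (v i))" for i
    by (rule sum.mono_neutral_cong_right) (use fin assms(2) in auto)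
  then have d: "\<forall>v\<in>S. ?d v = 0"
    using assms(1)[unfolded lin_indep_vecs_def, THEN conjunct2, THEN spec[of _ ?d]] c by simp
  show "\<forall>v\<in>T. c v = 0"
  proof
    fix v assume "v \<in> T"
    with d assms(2) have "?d v = 0"
      by blast
    with \<open>v \<in> T\<close> show "c v = 0"
      by simp
  qed
qed

lemma lin_indep_vecs_pairD:
  assumes "lin_indep_vecs k {u, v}" "u \<noteq> v"
    and "\<And>i. i \<le> k \<Longrightarrow> a * real_of_int (u i) + b * real_of_int (v i) = 0"
  shows "a = 0 \<and> b = 0"
proof -
  define c where "c = (\<lambda>w. if w = u then a else b)"
  have "\<forall>i\<le>k. (\<Sum>w\<in>{u,v}. c w * real_of_int (w i)) = 0"
    using assms(2,3) by (simp add: c_def)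
  then have "\<forall>w\<in>{u,v}. c w = 0"
    using assms(1) unfolding lin_indep_vecs_def by blast
  then show ?thesis
    using assms(2) by (auto simp: c_def)
qed

lemma lin_indep_vecs_tripleD:
  assumes "lin_indep_vecs k {u, v, w}" "u \<noteq> v" "u \<noteq> w" "v \<noteq> w"
    and "\<And>i. i \<le> k \<Longrightarrow>
      a * real_of_int (u i) + b * real_of_int (v i) + c * real_of_int (w i) = 0"
  shows "a = 0 \<and> b = 0 \<and> c = 0"
proof -
  define d where "d = (\<lambda>z. if z = u then a else if z = v then b else c)"
  have "\<forall>i\<le>k. (\<Sum>z\<in>{u,v,w}. d z * real_of_int (z i)) = 0"
    using assms(2-5) by (simp add: d_def add.assoc)
  then have "\<forall>z\<in>{u,v,w}. d z = 0"
    using assms(1) unfolding lin_indep_vecs_def by blast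
  then show ?thesis
    using assms(2-4) by (auto simp: d_def)
qed

lemma lin_indep_vecs_pairI:
  assumes "u 0 * v i \<noteq> v 0 * u i" "i \<le> k"
  shows "u \<noteq> v" "lin_indep_vecs k {u, v}"
proof -
  show ne: "u \<noteq> v"
    using assms by auto
  show "lin_indep_vecs k {u, v}"
    unfolding lin_indep_vecs_def
  proof (intro conjI allI impI)
    fix c :: "(nat \<Rightarrow> int) \<Rightarrow> real"
    assume "\<forall>i\<le>k. (\<Sum>w\<in>{u, v}. c w * real_of_int (w i)) = 0"
    then have e: "c u * real_of_int (u l) + c v * real_of_int (v l) = 0" if "l \<le> k" for l
      using ne that by auto
    have D: "real_of_int (u 0) * real_of_int (v i) - real_of_int (v 0) * real_of_int (u i) \<noteq> 0"
      using assms(1) by (simp flip: of_int_mult)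
    have "c u * (real_of_int (u 0) * real_of_int (v i) - real_of_int (v 0) * real_of_int (u i)) = 0"
      using e[OF le0] e[OF assms(2)] by algebra
    moreover have "c v * (real_of_int (u 0) * real_of_int (v i) - real_of_int (v 0) * real_of_int (u i)) = 0"
      using e[OF le0] e[OF assms(2)] by algebra
    ultimately show "\<forall>w\<in>{u, v}. c w = 0"
      using D by auto
  qed simp
qed

lemma lin_indep_vecs_singletonI:
  assumes "u i \<noteq> 0" "i \<le> k"
  shows "lin_indep_vecs k {u}"
  using assms by (auto simp: lin_indep_vecs_def)

text \<open>If every minor against \<open>w\<close> vanished, then, since
  \<open>w 0 \<noteq> 0\<close>, all members of \<open>S\<close> would be multiples of the one
  vector \<open>w\<close>, so two of them could not be independent.\<close>

lemma ex_nonzero_minor2: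
  assumes S: "lin_indep_vecs k S" "card S = 2" and w: "w 0 \<noteq> 0"
  obtains u i where "u \<in> S" "i \<in> {1..k}" "u 0 * w i \<noteq> w 0 * u i"
proof -
  obtain u v where uv: "S = {u, v}" "u \<noteq> v"
    using S(2) by (auto simp: card_2_iff)
  have "\<exists>z\<in>S. \<exists>i\<in>{1..k}. z 0 * w i \<noteq> w 0 * z i"
  proof (rule ccontr)
    assume "\<not> ?thesis"
    then have p: "z 0 * w i = w 0 * z i" if "z \<in> S" "i \<le> k" for z i
      using that by (cases "i = 0") (auto simp: mult.commute)
    have e: "real_of_int (z 0) * real_of_int (w i) = real_of_int (w 0) * real_of_int (z i)"
      if "z \<in> S" "i \<le> k" for z i
      using p[OF that] by (metis of_int_mult)
    have uS: "u \<in> S" and vS: "v \<in> S"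
      using uv(1) by auto
    \<comment> \<open>Multiples of \<open>w\<close> satisfy \<open>v 0 * u - u 0 * v = 0\<close>.
      Independence then forces \<open>u 0 = 0\<close>, and proportionality to \<open>w\<close> makes
      every entry of \<open>u\<close> vanish.\<close>
    have "real_of_int (v 0) * real_of_int (u i) + (- real_of_int (u 0)) * real_of_int (v i) = 0"
      if "i \<le> k" for i
    proof -
      have "real_of_int (w 0) * (real_of_int (v 0) * real_of_int (u i)
          + (- real_of_int (u 0)) * real_of_int (v i)) = 0"
        using e[OF uS that] e[OF vS that] by algebra
      then show ?thesis
        using w by simp
    qed
    from lin_indep_vecs_pairD[OF S(1)[unfolded uv(1)] uv(2) this]
    have "u 0 = 0"
      by simp
    then have "u i = 0" if "i \<le> k" for i
      using p[of u i] that uv(1) w by simp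
    then have "1 * real_of_int (u i) + 0 * real_of_int (v i) = 0" if "i \<le> k" for i
      using that by simp
    from lin_indep_vecs_pairD[OF S(1)[unfolded uv(1)] uv(2) this] show False
      by simp
  qed
  then show ?thesis
    using that by blast
qed

text \<open>The 3 by 3 determinant with rows \<open>x\<close>, \<open>y\<close>, \<open>u\<close>
  and columns \<open>0\<close>, \<open>c\<close>, \<open>i\<close>, expanded along column
  \<open>0\<close>.\<close>

definition minor3 :: "(nat \<Rightarrow> int) \<Rightarrow> (nat \<Rightarrow> int) \<Rightarrow> (nat \<Rightarrow> int) \<Rightarrow> nat \<Rightarrow> nat \<Rightarrow> int" where
  "minor3 x y u c i = x 0 * (y c * u i - y i * u c) - y 0 * (x c * u i - x i * u c)
     + u 0 * (x c * y i - x i * y c)"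

text \<open>By \<open>D\<close> the vectors \<open>x\<close> and \<open>y\<close> have a nonzero
  minor in columns \<open>0\<close> and \<open>c\<close>. If all 3 by 3 minors bordering it
  vanished, every member of \<open>S\<close> would lie in the span of \<open>x\<close> and
  \<open>y\<close>, and three vectors in a plane are dependent.\<close>

lemma ex_nonzero_minor3:
  assumes S: "lin_indep_vecs k S" "card S = 3" and D: "x 0 * y c \<noteq> y 0 * x c" and c: "c \<le> k"
  obtains u i where "u \<in> S" "i \<in> {1..k}" "minor3 x y u c i \<noteq> 0"
proof -
  obtain u v w where uvw: "S = {u, v, w}" "u \<noteq> v" "u \<noteq> w" "v \<noteq> w"
    using S(2) by (auto simp: card_3_iff)
  have "\<exists>z\<in>S. \<exists>i\<in>{1..k}. minor3 x y z c i \<noteq> 0"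
  proof (rule ccontr)
    assume none: "\<not> ?thesis"
    have p: "minor3 x y z c i = 0" if "z \<in> S" "i \<le> k" for z i
    proof (cases "i = 0")
      \<comment> \<open>For \<open>i = 0\<close> the determinant has a repeated column.\<close>
      case True
      then show ?thesis
        by (simp add: minor3_def algebra_simps)
    next
      case False
      then show ?thesis
        using none that by auto
    qed
    \<comment> \<open>\<open>A z / d\<close> and \<open>B z / d\<close> are the coefficients that
      Cramer's rule gives for \<open>z\<close> in terms of \<open>x\<close> and
      \<open>y\<close>.\<close>
    define d where "d = real_of_int (x 0 * y c - y 0 * x c)"
    define A where "A z = real_of_int (z 0 * y c - z c * y 0)" for z
    define B where "B z = real_of_int (x 0 * z c - x c * z 0)" for z
    have d0: "d \<noteq> 0"
      using D by (simp add: d_def del: of_int_diff)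
    have e: "d * real_of_int (z i) = A z * real_of_int (x i) + B z * real_of_int (y i)"
      if "z \<in> S" "i \<le> k" for z i
    proof -
      have "(x 0 * y c - y 0 * x c) * z i = (z 0 * y c - z c * y 0) * x i + (x 0 * z c - x c * z 0) * y i"
        using p[OF that] unfolding minor3_def by algebra
      then show ?thesis
        unfolding d_def A_def B_def by (metis of_int_add of_int_mult)
    qed
    have uS: "u \<in> S" and vS: "v \<in> S" and wS: "w \<in> S"
      using uvw(1) by auto
    have zero: "a = 0 \<and> b = 0 \<and> g = 0"
      if "a * A u + b * A v + g * A w = 0" "a * B u + b * B v + g * B w = 0" for a b g
    proof (rule lin_indep_vecs_tripleD[OF S(1)[unfolded uvw(1)] uvw(2-4)])
      fix i assume i: "i \<le> k"
      have "d * (a * real_of_int (u i) + b * real_of_int (v i) + g * real_of_int (w i))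
        = (a * A u + b * A v + g * A w) * real_of_int (x i)
          + (a * B u + b * B v + g * B w) * real_of_int (y i)"
      proof -
        have "d * (a * real_of_int (u i) + b * real_of_int (v i) + g * real_of_int (w i))
          = a * (d * real_of_int (u i)) + b * (d * real_of_int (v i)) + g * (d * real_of_int (w i))"
          by (simp add: algebra_simps)
        then show ?thesis
          unfolding e[OF uS i] e[OF vS i] e[OF wS i] by (simp add: algebra_simps)
      qed
      then show "a * real_of_int (u i) + b * real_of_int (v i) + g * real_of_int (w i) = 0"
        using that d0 by simp
    qed
    \<comment> \<open>The coefficients form the cross product of the triples of \<open>A\<close> and
      \<open>B\<close> values, which is orthogonal to both. With its third entry zero, relations
      between \<open>u\<close> and \<open>v\<close> alone give \<open>A u = B u = 0\<close>.\<close>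
    have m: "A u * B v - A v * B u = 0"
      using zero[of "A v * B w - A w * B v" "A w * B u - A u * B w" "A u * B v - A v * B u"]
      by (simp add: algebra_simps)
    have "A u = 0" "B u = 0"
      using zero[of "A v" "- A u" 0] zero[of "B v" "- B u" 0] m by (auto simp: algebra_simps)
    then show False
      using zero[of 1 0 0] by simp
  qed
  then show ?thesis
    using that by blast
qed

section \<open>Lower bounds on exponents from integral minors\<close>

lemma powr_exponent_ge:
  fixes C Q s :: real
  assumes "1 \<le> C * Q powr s" "Q > 1" "C > 0"
  shows "s \<ge> - ln C / ln Q"
proof -
  have "0 \<le> ln (C * Q powr s)"
    using assms by simp
  also have "\<dots> = ln C + s * ln Q"
    using assms(2,3) by (simp add: ln_mult ln_powr)
  finally show ?thesis
    using assms(2) by (simp add: field_simps)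
qed

text \<open>A nonzero integral minor is at least 1 in absolute value. Subtracting column
  \<open>i\<close> from \<open>zeta i\<close> times column \<open>0\<close> replaces its entries by
  approximation errors, so each of the two products is at most
  \<open>Q powr (1 + \<theta> + \<eta> - 1 / real k)\<close>.\<close>

lemma sol_set_minor2_bound:
  assumes Q: "Q > 1" and u: "u \<in> sol_set k zeta Q \<theta>" and w: "w \<in> sol_set k zeta Q \<eta>"
    and i: "i \<in> {1..k}" and D: "u 0 * w i \<noteq> w 0 * u i"
  shows "\<theta> + \<eta> \<ge> 1 / real k - 1 - ln 2 / ln Q"
proof -
  let ?L = "\<lambda>v. zeta i * real_of_int (v 0) - real_of_int (v i)"
  have "1 \<le> \<bar>u 0 * w i - w 0 * u i\<bar>"
    using D by linarith
  then have "1 \<le> \<bar>real_of_int (u 0 * w i - w 0 * u i)\<bar>"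
    by linarith
  also have "real_of_int (u 0 * w i - w 0 * u i)
      = real_of_int (w 0) * ?L u - real_of_int (u 0) * ?L w"
    by (simp add: algebra_simps)
  also have "\<bar>\<dots>\<bar> \<le> \<bar>real_of_int (w 0)\<bar> * \<bar>?L u\<bar> + \<bar>real_of_int (u 0)\<bar> * \<bar>?L w\<bar>"
    by (metis abs_mult abs_triangle_ineq4)
  also have "\<dots> \<le> Q powr (1 + \<eta>) * Q powr (\<theta> - 1 / real k)
      + Q powr (1 + \<theta>) * Q powr (\<eta> - 1 / real k)"
    using u w i unfolding sol_set_def by (intro add_mono mult_mono) auto
  also have "\<dots> = 2 * Q powr (1 + \<theta> + \<eta> - 1 / real k)"
    by (simp add: powr_add[symmetric] algebra_simps)
  finally have "- ln 2 / ln Q \<le> 1 + \<theta> + \<eta> - 1 / real k"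
    by (rule powr_exponent_ge) (use Q in auto)
  then show ?thesis
    by simp
qed

text \<open>The same argument with both columns \<open>c\<close> and \<open>i\<close> replaced by
  errors. Each of the six products has one first entry and two errors, and its exponent does not
  depend on which vector supplies the first entry.\<close>

lemma sol_set_minor3_bound:
  assumes Q: "Q > 1" and x: "x \<in> sol_set k zeta Q \<alpha>" and y: "y \<in> sol_set k zeta Q \<beta>"
    and u: "u \<in> sol_set k zeta Q \<theta>"
    and i: "i \<in> {1..k}" and c: "c \<in> {1..k}" and D: "minor3 x y u c i \<noteq> 0"
  shows "\<alpha> + \<beta> + \<theta> \<ge> 2 / real k - 1 - ln 6 / ln Q"
proof -
  let ?L = "\<lambda>i v. zeta i * real_of_int (v 0) - real_of_int (v i)"
  define P where "P = Q powr (1 + \<alpha> + \<beta> + \<theta> - 2 / real k)"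
  have term_le: "\<bar>real_of_int (a 0) * (?L i1 b * ?L i2 d)\<bar> \<le> P"
    if "a \<in> sol_set k zeta Q s" "b \<in> sol_set k zeta Q t" "d \<in> sol_set k zeta Q r"
      "i1 \<in> {1..k}" "i2 \<in> {1..k}" "s + t + r = \<alpha> + \<beta> + \<theta>" for a b d s t r i1 i2
  proof -
    have "\<bar>real_of_int (a 0) * (?L i1 b * ?L i2 d)\<bar>
        \<le> Q powr (1 + s) * (Q powr (t - 1 / real k) * Q powr (r - 1 / real k))"
      unfolding abs_mult using that unfolding sol_set_def by (intro mult_mono) auto
    also have "\<dots> = Q powr (1 + (s + t + r) - 2 / real k)"
      by (simp add: powr_add[symmetric] algebra_simps)
    finally show ?thesis
      using that(6) by (simp add: P_def add.assoc)
  qed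
  have six: "\<bar>a1 - a2 - a3 + a4 + a5 - a6\<bar> \<le> 6 * P"
    if "\<bar>a1\<bar> \<le> P" "\<bar>a2\<bar> \<le> P" "\<bar>a3\<bar> \<le> P" "\<bar>a4\<bar> \<le> P" "\<bar>a5\<bar> \<le> P" "\<bar>a6\<bar> \<le> P"
    for a1 a2 a3 a4 a5 a6
    using that unfolding abs_le_iff by linarith
  have "1 \<le> \<bar>minor3 x y u c i\<bar>"
    using D by linarith
  then have "1 \<le> \<bar>real_of_int (minor3 x y u c i)\<bar>"
    by linarith
  also have "real_of_int (minor3 x y u c i)
      = real_of_int (x 0) * (?L c y * ?L i u) - real_of_int (x 0) * (?L i y * ?L c u)
      - real_of_int (y 0) * (?L c x * ?L i u) + real_of_int (y 0) * (?L i x * ?L c u)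
      + real_of_int (u 0) * (?L c x * ?L i y) - real_of_int (u 0) * (?L i x * ?L c y)"
    unfolding minor3_def by (simp add: algebra_simps)
  also have "\<bar>\<dots>\<bar> \<le> 6 * P"
    by (rule six[OF term_le[OF x y u c i] term_le[OF x y u i c] term_le[OF y x u c i]
        term_le[OF y x u i c] term_le[OF u x y c i] term_le[OF u x y i c]]) auto
  finally have "- ln 6 / ln Q \<le> 1 + \<alpha> + \<beta> + \<theta> - 2 / real k"
    unfolding P_def by (rule powr_exponent_ge) (use Q in auto)
  then show ?thesis
    by simp
qed

section \<open>Bounds for the minima from two independent approximations\<close>

text \<open>An infimum of reals lies below a member only when the set is bounded below; the last
  premise provides such a bound.\<close>

lemma psi_le:
  assumes "S \<subseteq> sol_set k zeta Q \<theta>" "card S = j" "lin_indep_vecs k S"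
    and "\<And>\<theta> S. S \<subseteq> sol_set k zeta Q \<theta> \<Longrightarrow> card S = j \<Longrightarrow> lin_indep_vecs k S \<Longrightarrow> l \<le> \<theta>"
  shows "psi k zeta j Q \<le> \<theta>"
  unfolding psi_def by (rule cInf_lower) (use assms in \<open>auto intro!: bdd_belowI[of _ l]\<close>)

text \<open>Here the witness \<open>S\<close> keeps the set nonempty, as the infimum of the empty
  set would be an arbitrary real.\<close>

lemma psi_ge:
  assumes "S \<subseteq> sol_set k zeta Q \<theta>" "card S = j" "lin_indep_vecs k S"
    and "\<And>\<theta> S. S \<subseteq> sol_set k zeta Q \<theta> \<Longrightarrow> card S = j \<Longrightarrow> lin_indep_vecs k S \<Longrightarrow> l \<le> \<theta>"
  shows "l \<le> psi k zeta j Q"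
  unfolding psi_def by (rule cInf_greatest) (use assms in auto)

text \<open>At exponent \<open>1 / k\<close> errors up to \<open>Q powr 0 = 1\<close> are allowed,
  and the errors of the unit vectors are \<open>\<bar>zeta i\<bar>\<close>, 0 or 1.\<close>

lemma ex_lin_indep_unit_vecs:
  assumes Q: "Q > 1" and z: "\<forall>i\<in>{1..k}. \<bar>zeta i\<bar> \<le> 1" and j: "j \<le> k + 1"
  obtains S where "S \<subseteq> sol_set k zeta Q (1 / real k)" "card S = j" "lin_indep_vecs k S"
proof
  define e where "e l = (\<lambda>i::nat. if i = l then 1 else 0::int)" for l
  have inj: "inj_on e A" for A
  proof (rule inj_onI)
    fix a b assume "e a = e b"
    then have "e a a = e b a"
      by simp
    then show "a = b"
      by (auto simp: e_def split: if_splits)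
  qed
  let ?S = "e ` {..<j}"
  show "card ?S = j"
    by (simp add: card_image[OF inj])
  have "1 \<le> Q powr (1 + 1 / real k)"
    using Q by (intro ge_one_powr_ge_zero) auto
  then show "?S \<subseteq> sol_set k zeta Q (1 / real k)"
    using Q z j by (auto simp: sol_set_def int_vec_def e_def)
  show "lin_indep_vecs k ?S"
    unfolding lin_indep_vecs_def
  proof (intro conjI allI impI)
    fix c :: "(nat \<Rightarrow> int) \<Rightarrow> real"
    assume c: "\<forall>i\<le>k. (\<Sum>v\<in>?S. c v * real_of_int (v i)) = 0"
    have "c (e l) = 0" if l: "l < j" for l
    proof -
      have "0 = (\<Sum>v\<in>?S. c v * real_of_int (v l))"
        using c l j by simp
      also have "\<dots> = (\<Sum>m<j. c (e m) * real_of_int (e m l))"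
        by (simp add: sum.reindex[OF inj])
      also have "\<dots> = (\<Sum>m<j. if m = l then c (e m) else 0)"
        by (rule sum.cong) (auto simp: e_def)
      also have "\<dots> = c (e l)"
        using l by simp
      finally show ?thesis
        by simp
    qed
    then show "\<forall>v\<in>?S. c v = 0"
      by blast
  qed simp
qed

text \<open>In the next three lemmas, the gap between the upper and the lower bound is
  \<open>\<alpha> + \<beta> + 1 - 1 / k\<close> up to \<open>O(1 / ln Q)\<close>: the bounds are sharp if the two given vectors nearly
  attain equality in Minkowski's theorem, the remaining minima being at most \<open>1 / k\<close>.\<close>

lemma psi_1_bounds:
  assumes Q: "Q > 1" and x: "x \<in> sol_set k zeta Q \<alpha>" and y: "y \<in> sol_set k zeta Q \<beta>"
    and nz: "x 0 \<noteq> 0" "y 0 \<noteq> 0"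
    and c: "c \<in> {1..k}" and D: "x 0 * y c \<noteq> y 0 * x c"
  shows "1 / real k - 1 - ln 2 / ln Q - max \<alpha> \<beta> \<le> psi k zeta 1 Q"
    and "psi k zeta 1 Q \<le> min \<alpha> \<beta>"
proof -
  let ?l = "1 / real k - 1 - ln 2 / ln Q - max \<alpha> \<beta>"
  have low: "?l \<le> \<theta>"
    if S: "S \<subseteq> sol_set k zeta Q \<theta>" "card S = 1" "lin_indep_vecs k S" for S \<theta>
  proof -
    obtain u where u: "S = {u}"
      using S(2) card_1_singletonE by blast
    have us: "u \<in> sol_set k zeta Q \<theta>"
      using S u by simp
    show ?thesis
    proof (cases "\<exists>i\<in>{1..k}. u 0 * x i \<noteq> x 0 * u i")
      case True
      then obtain i where "i \<in> {1..k}" "u 0 * x i \<noteq> x 0 * u i"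
        by blast
      from sol_set_minor2_bound[OF Q us x this] show ?thesis
        by linarith
    next
      case False
      \<comment> \<open>A vector proportional to both \<open>x\<close> and \<open>y\<close> would be
        zero, because \<open>D\<close> says that these two are not proportional to each
        other.\<close>
      have "\<exists>i\<in>{1..k}. u 0 * y i \<noteq> y 0 * u i"
      proof (rule ccontr)
        assume n: "\<not> ?thesis"
        have "u 0 * x c = x 0 * u c" "u 0 * y c = y 0 * u c"
          using False n c by auto
        then have "u 0 * (x 0 * y c - y 0 * x c) = 0"
          by algebra
        then have "u 0 = 0"
          using D by simp
        then have "u i = 0" if "i \<le> k" for i
          using False nz(1) that by (cases "i = 0") auto
        then show False
          using S(3)[unfolded u lin_indep_vecs_def, THEN conjunct2, THEN spec[of _ "\<lambda>_. 1"]] by simp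
      qed
      then obtain i where "i \<in> {1..k}" "u 0 * y i \<noteq> y 0 * u i"
        by blast
      from sol_set_minor2_bound[OF Q us y this] show ?thesis
        by linarith
    qed
  qed
  have xi: "lin_indep_vecs k {x}" and yi: "lin_indep_vecs k {y}"
    using nz lin_indep_vecs_singletonI by blast+
  show "?l \<le> psi k zeta 1 Q"
    by (rule psi_ge[OF _ _ xi low]) (use x in auto)
  have "psi k zeta 1 Q \<le> \<alpha>"
    by (rule psi_le[OF _ _ xi low]) (use x in auto)
  moreover have "psi k zeta 1 Q \<le> \<beta>"
    by (rule psi_le[OF _ _ yi low]) (use y in auto)
  ultimately show "psi k zeta 1 Q \<le> min \<alpha> \<beta>"
    by simp
qed

lemma psi_2_bounds:
  assumes Q: "Q > 1" and x: "x \<in> sol_set k zeta Q \<alpha>" and y: "y \<in> sol_set k zeta Q \<beta>"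
    and nz: "x 0 \<noteq> 0" "y 0 \<noteq> 0"
    and c: "c \<in> {1..k}" and D: "x 0 * y c \<noteq> y 0 * x c"
    and z: "\<forall>i\<in>{1..k}. \<bar>zeta i\<bar> \<le> 1"
  shows "1 / real k - 1 - ln 2 / ln Q - min \<alpha> \<beta> \<le> psi k zeta 2 Q"
    and "psi k zeta 2 Q \<le> max \<alpha> \<beta>" and "psi k zeta 2 Q \<le> 1 / real k"
proof -
  let ?l = "1 / real k - 1 - ln 2 / ln Q - min \<alpha> \<beta>"
  have low: "?l \<le> \<theta>"
    if S: "S \<subseteq> sol_set k zeta Q \<theta>" "card S = 2" "lin_indep_vecs k S" for S \<theta>
  proof -
    \<comment> \<open>\<open>S\<close> contains a vector not proportional to \<open>x\<close> and
      one not proportional to \<open>y\<close>, possibly different. Using both bounds gives the one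
      with \<open>min \<alpha> \<beta>\<close>, in contrast to a single vector, which may be
      proportional to the better approximation.\<close>
    obtain u i where u: "u \<in> S" "i \<in> {1..k}" "u 0 * x i \<noteq> x 0 * u i"
      by (rule ex_nonzero_minor2[where w = x, OF S(3,2) nz(1)])
    obtain v l where v: "v \<in> S" "l \<in> {1..k}" "v 0 * y l \<noteq> y 0 * v l"
      by (rule ex_nonzero_minor2[where w = y, OF S(3,2) nz(2)])
    show ?thesis
      using sol_set_minor2_bound[OF Q subsetD[OF S(1) u(1)] x u(2,3)]
        sol_set_minor2_bound[OF Q subsetD[OF S(1) v(1)] y v(2,3)] by linarith
  qed
  have xy: "x \<noteq> y" "lin_indep_vecs k {x, y}"
    using lin_indep_vecs_pairI[of x y c k] D c by auto
  have sub: "{x, y} \<subseteq> sol_set k zeta Q (max \<alpha> \<beta>)"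
    using x y Q sol_set_mono[of Q \<alpha> "max \<alpha> \<beta>" k zeta] sol_set_mono[of Q \<beta> "max \<alpha> \<beta>" k zeta] by auto
  show "?l \<le> psi k zeta 2 Q"
    by (rule psi_ge[OF sub _ xy(2) low]) (use xy in auto)
  show "psi k zeta 2 Q \<le> max \<alpha> \<beta>"
    by (rule psi_le[OF sub _ xy(2) low]) (use xy in auto)
  have "2 \<le> k + 1"
    using c by simp
  then obtain S where S: "S \<subseteq> sol_set k zeta Q (1 / real k)" "card S = 2" "lin_indep_vecs k S"
    by (rule ex_lin_indep_unit_vecs[OF Q z])
  show "psi k zeta 2 Q \<le> 1 / real k"
    by (rule psi_le[OF S low])
qed

lemma psi_ge_3_bounds:
  assumes Q: "Q > 1" and x: "x \<in> sol_set k zeta Q \<alpha>" and y: "y \<in> sol_set k zeta Q \<beta>"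
    and c: "c \<in> {1..k}" and D: "x 0 * y c \<noteq> y 0 * x c"
    and z: "\<forall>i\<in>{1..k}. \<bar>zeta i\<bar> \<le> 1" and j: "j \<in> {3..k + 1}"
  shows "2 / real k - 1 - ln 6 / ln Q - \<alpha> - \<beta> \<le> psi k zeta j Q"
    and "psi k zeta j Q \<le> 1 / real k"
proof -
  let ?l = "2 / real k - 1 - ln 6 / ln Q - \<alpha> - \<beta>"
  have low: "?l \<le> \<theta>"
    if S: "S \<subseteq> sol_set k zeta Q \<theta>" "card S = j" "lin_indep_vecs k S" for S \<theta>
  proof -
    \<comment> \<open>Three independent vectors already give the bound, so it is the same for all
      \<open>j \<ge> 3\<close>.\<close>
    obtain T where T: "T \<subseteq> S" "card T = 3"
      using obtain_subset_with_card_n[of 3 S] S(2) j by auto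
    obtain u i where u: "u \<in> T" "i \<in> {1..k}" "minor3 x y u c i \<noteq> 0"
      using ex_nonzero_minor3[OF lin_indep_vecs_subset[OF S(3) T(1)] T(2) D] c by auto
    have "u \<in> sol_set k zeta Q \<theta>"
      using u(1) T(1) S(1) by blast
    from sol_set_minor3_bound[OF Q x y this u(2) c u(3)] show ?thesis
      by linarith
  qed
  have "j \<le> k + 1"
    using j by simp
  then obtain S where S: "S \<subseteq> sol_set k zeta Q (1 / real k)" "card S = j" "lin_indep_vecs k S"
    by (rule ex_lin_indep_unit_vecs[OF Q z])
  show "?l \<le> psi k zeta j Q"
    by (rule psi_ge[OF S low])
  show "psi k zeta j Q \<le> 1 / real k"
    by (rule psi_le[OF S low])
qed

section \<open>Limsup and liminf at infinity from eventual bounds and one sequence\<close>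

lemma Limsup_at_top_eqI:
  fixes f :: "real \<Rightarrow> real"
  assumes up: "\<And>\<epsilon>. \<epsilon> > 0 \<Longrightarrow> eventually (\<lambda>Q. f Q \<le> L + \<epsilon>) at_top"
    and s: "filterlim s at_top sequentially" and fs: "(\<lambda>n. f (s n)) \<longlonglongrightarrow> L"
  shows "Limsup at_top (\<lambda>Q. ereal (f Q)) = ereal L"
proof (rule antisym)
  show "Limsup at_top (\<lambda>Q. ereal (f Q)) \<le> ereal L"
  proof (rule ereal_le_epsilon2)
    fix \<epsilon> :: real assume "\<epsilon> > 0"
    show "Limsup at_top (\<lambda>Q. ereal (f Q)) \<le> ereal L + ereal \<epsilon>"
      by (rule Limsup_bounded) (use up[OF \<open>\<epsilon> > 0\<close>] in simp)
  qed
  have "ereal L = Limsup sequentially (\<lambda>n. ereal (f (s n)))"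
    using fs by (intro lim_imp_Limsup[symmetric]) auto
  also have "\<dots> \<le> Limsup (filtermap s sequentially) (\<lambda>Q. ereal (f Q))"
    by (rule Limsup_filtermap_ge)
  also have "\<dots> \<le> Limsup at_top (\<lambda>Q. ereal (f Q))"
    using s unfolding filterlim_def Limsup_def by (intro INF_superset_mono) (auto simp: le_filter_def)
  finally show "ereal L \<le> Limsup at_top (\<lambda>Q. ereal (f Q))" .
qed

lemma Liminf_at_top_eqI:
  fixes f :: "real \<Rightarrow> real"
  assumes "\<And>\<epsilon>. \<epsilon> > 0 \<Longrightarrow> eventually (\<lambda>Q. L - \<epsilon> \<le> f Q) at_top"
    and "filterlim s at_top sequentially" and "(\<lambda>n. f (s n)) \<longlonglongrightarrow> L"
  shows "Liminf at_top (\<lambda>Q. ereal (f Q)) = ereal L"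
proof -
  have "Limsup at_top (\<lambda>Q. ereal (- f Q)) = ereal (- L)"
  proof (rule Limsup_at_top_eqI[OF _ assms(2)])
    show "\<forall>\<^sub>F Q in at_top. - f Q \<le> - L + \<epsilon>" if "\<epsilon> > 0" for \<epsilon>
      using assms(1)[OF that] by eventually_elim simp
  qed (use assms(3) in \<open>auto intro: tendsto_minus\<close>)
  then show ?thesis
    using ereal_Liminf_uminus[of at_top "\<lambda>Q. ereal (- f Q)"] by simp
qed

section \<open>The factorial series and their truncations\<close>

definition fact_zeta :: "nat \<Rightarrow> nat \<Rightarrow> real" where
  "fact_zeta k j = (\<Sum>n. 1 / 2 ^ fact (n * k + j))"

text \<open>Series \<open>j\<close> padded with zeros over all indices \<open>l\<close>, so that all
  \<open>k\<close> series can be truncated at the same place.\<close>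

definition fact_term :: "nat \<Rightarrow> nat \<Rightarrow> nat \<Rightarrow> real" where
  "fact_term k j l = (if l \<in> range (\<lambda>n. n * k + j) then 1 / 2 ^ fact l else 0)"

text \<open>Entry \<open>i\<close> is \<open>2 ^ fact m\<close> times the truncation of series
  \<open>i\<close> after index \<open>m\<close>; it is integral because
  \<open>fact l \<le> fact m\<close> for \<open>l \<le> m\<close>.\<close>

definition fact_vec :: "nat \<Rightarrow> nat \<Rightarrow> nat \<Rightarrow> int" where
  "fact_vec k m i = (if i = 0 then 2 ^ fact m
     else if i \<le> k then \<Sum>l\<le>m. if l \<in> range (\<lambda>n. n * k + i) then 2 ^ (fact m - fact l) else 0
     else 0)"

lemma fact_term_nonneg: "0 \<le> fact_term k j l"
  by (simp add: fact_term_def)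

lemma fact_term_le: "fact_term k j l \<le> (1 / 2) ^ fact l"
  by (simp add: fact_term_def power_one_over)

text \<open>Beyond \<open>fact (Suc m)\<close> the exponents grow by at least 1 per index, so a
  geometric series of ratio 1/2 dominates the tail. Its sum is twice its first term.\<close>

lemma fact_add_ge: "fact (Suc m) + l \<le> (fact (l + Suc m) :: nat)"
proof (induction l)
  case (Suc l)
  have "(0::nat) < (l + Suc m) * fact (l + Suc m)"
    by (intro mult_pos_pos) auto
  then show ?case
    using Suc unfolding add_Suc fact_Suc mult_Suc of_nat_id by linarith
qed simp

lemma half_power_fact_le: "(1 / 2 :: real) ^ fact (l + Suc m) \<le> (1 / 2) ^ fact (Suc m) * (1 / 2) ^ l"
  unfolding power_add[symmetric] by (rule power_decreasing[OF fact_add_ge]) auto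

lemma summable_fact_term: "summable (fact_term k j)"
proof (rule summable_comparison_test')
  show "summable (\<lambda>l. (1 / 2 :: real) ^ l)"
    by (simp add: summable_geometric)
  show "norm (fact_term k j l) \<le> (1 / 2) ^ l" if "0 \<le> l" for l
  proof -
    have "(1 / 2 :: real) ^ fact l \<le> (1 / 2) ^ l"
      by (rule power_decreasing[OF fact_ge_self]) auto
    then show ?thesis
      unfolding real_norm_def
      using fact_term_le[of k j l] fact_term_nonneg[of k j l] by linarith
  qed
qed

lemma
  assumes "k \<ge> 1"
  shows summable_fact_zeta: "summable (\<lambda>n. 1 / 2 ^ fact (n * k + j) :: real)"
    and fact_zeta_eq_suminf: "fact_zeta k j = suminf (fact_term k j)"
proof -
  have g: "strict_mono (\<lambda>n. n * k + j)"
    using assms by (auto intro!: strict_monoI)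
  have eq: "(\<lambda>n. 1 / 2 ^ fact (n * k + j)) = (\<lambda>n. fact_term k j (n * k + j))"
    by (rule ext, unfold fact_term_def, subst if_P) auto
  have 0: "fact_term k j l = 0" if "l \<notin> range (\<lambda>n. n * k + j)" for l
    using that by (simp add: fact_term_def)
  show "summable (\<lambda>n. 1 / 2 ^ fact (n * k + j) :: real)"
    unfolding eq using summable_mono_reindex[where f = "fact_term k j", OF g 0] summable_fact_term by blast
  show "fact_zeta k j = suminf (fact_term k j)"
    unfolding fact_zeta_def eq using suminf_mono_reindex[where f = "fact_term k j", OF g 0] by blast
qed

lemma fact_zeta_tail:
  assumes "k \<ge> 1"
  shows "0 \<le> fact_zeta k j - (\<Sum>l\<le>m. fact_term k j l)"
    and "fact_zeta k j - (\<Sum>l\<le>m. fact_term k j l) \<le> 2 / 2 ^ fact (Suc m)"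
proof -
  have s: "summable (\<lambda>l. fact_term k j (l + Suc m))"
    using summable_fact_term summable_iff_shift by blast
  have eq: "fact_zeta k j - (\<Sum>l\<le>m. fact_term k j l) = (\<Sum>l. fact_term k j (l + Suc m))"
    using suminf_minus_initial_segment[OF summable_fact_term, of k j "Suc m"]
    by (simp add: fact_zeta_eq_suminf[OF assms] lessThan_Suc_atMost)
  show "0 \<le> fact_zeta k j - (\<Sum>l\<le>m. fact_term k j l)"
    unfolding eq by (rule suminf_nonneg[OF s]) (rule fact_term_nonneg)
  have g: "(\<lambda>l. (1 / 2 :: real) ^ fact (Suc m) * (1 / 2) ^ l) sums ((1 / 2) ^ fact (Suc m) * 2)"
    using geometric_sums[of "1 / 2 :: real"] by (intro sums_mult) simp
  have "(\<Sum>l. fact_term k j (l + Suc m)) \<le> (\<Sum>l. (1 / 2) ^ fact (Suc m) * (1 / 2) ^ l)"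
    by (rule suminf_le[OF _ s sums_summable[OF g]])
      (rule order_trans[OF fact_term_le half_power_fact_le])
  then show "fact_zeta k j - (\<Sum>l\<le>m. fact_term k j l) \<le> 2 / 2 ^ fact (Suc m)"
    unfolding eq sums_unique[OF g, symmetric] by (simp add: power_one_over)
qed

lemma abs_fact_zeta_le_1:
  assumes "j \<in> {1..k}"
  shows "\<bar>fact_zeta k j\<bar> \<le> 1"
proof -
  \<comment> \<open>As \<open>j \<ge> 1\<close>, truncation at index 0 leaves nothing, and the tail
    bound there is \<open>2 / 2 ^ fact 1 = 1\<close>.\<close>
  have "fact_term k j 0 = 0"
    using assms by (auto simp: fact_term_def)
  then show ?thesis
    using fact_zeta_tail[of k j 0] assms by simp
qed

lemma fact_vec_0: "fact_vec k m 0 = 2 ^ fact m"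
  by (simp add: fact_vec_def)

lemma real_fact_vec:
  assumes "i \<in> {1..k}"
  shows "real_of_int (fact_vec k m i) = 2 ^ fact m * (\<Sum>l\<le>m. fact_term k i l)"
proof -
  have "real_of_int (if l \<in> range (\<lambda>n. n * k + i) then 2 ^ (fact m - fact l) else 0)
      = 2 ^ fact m * fact_term k i l" if "l \<le> m" for l
  proof -
    have "(2::real) ^ (fact m - fact l) = 2 ^ fact m / 2 ^ fact l"
      using fact_mono_nat[OF that] by (intro power_diff) auto
    then show ?thesis
      unfolding fact_term_def by (simp only: if_distrib[of real_of_int] of_int_power of_int_numeral of_int_0) simp
  qed
  then show ?thesis
    using assms by (simp add: fact_vec_def sum_distrib_left)
qed

lemma fact_vec_error:
  assumes "i \<in> {1..k}"
  shows "\<bar>fact_zeta k i * real_of_int (fact_vec k m 0) - real_of_int (fact_vec k m i)\<bar>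
    \<le> 2 ^ fact m * (2 / 2 ^ fact (Suc m))"
proof -
  have "fact_zeta k i * real_of_int (fact_vec k m 0) - real_of_int (fact_vec k m i)
      = 2 ^ fact m * (fact_zeta k i - (\<Sum>l\<le>m. fact_term k i l))"
    by (simp add: real_fact_vec[OF assms] fact_vec_0 algebra_simps)
  then show ?thesis
    using fact_zeta_tail[of k i m] assms by (simp only: abs_mult) (intro mult_mono, auto)
qed

text \<open>Column \<open>m mod k + 1\<close> belongs to the series that contains index
  \<open>Suc m\<close>. Its truncation changes between \<open>m\<close> and \<open>Suc m\<close>, so
  the two vectors have different ratios in this column.\<close>

lemma fact_vec_minor:
  assumes "k \<ge> 1"
  shows "fact_vec k m 0 * fact_vec k (Suc m) (m mod k + 1) \<noteq>
    fact_vec k (Suc m) 0 * fact_vec k m (m mod k + 1)"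
proof -
  let ?c = "m mod k + 1"
  have c: "?c \<in> {1..k}"
    using assms by (simp add: Suc_leI)
  have "Suc m = (m div k) * k + ?c"
    by simp
  then have "Suc m \<in> range (\<lambda>n. n * k + ?c)"
    by blast
  then have "(\<Sum>l\<le>Suc m. fact_term k ?c l) \<noteq> (\<Sum>l\<le>m. fact_term k ?c l)"
    by (simp add: fact_term_def)
  then have "real_of_int (fact_vec k m 0 * fact_vec k (Suc m) ?c) \<noteq>
      real_of_int (fact_vec k (Suc m) 0 * fact_vec k m ?c)"
    by (simp only: of_int_mult real_fact_vec[OF c] fact_vec_0) simp
  then show ?thesis
    by (metis of_int_eq_iff)
qed

text \<open>The two inequalities are the logarithms of the size condition and of the error bound
  \<open>2 * 2 ^ fact m / 2 ^ fact (Suc m)\<close>.\<close>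

lemma fact_vec_in_sol_set:
  assumes Q: "Q > 1"
    and 1: "ln 2 * fact m \<le> (1 + \<theta>) * ln Q"
    and 2: "ln 2 * fact m + ln 2 - ln 2 * fact (Suc m) \<le> (\<theta> - 1 / real k) * ln Q"
  shows "fact_vec k m \<in> sol_set k (fact_zeta k) Q \<theta>"
proof -
  have e: "(2::real) ^ n = exp (ln 2 * real n)" for n :: nat
    by (simp add: exp_of_nat2_mult)
  have p: "Q powr s = exp (s * ln Q)" for s
    using Q by (simp add: powr_def)
  have "(2::real) ^ fact m \<le> Q powr (1 + \<theta>)"
    unfolding e p using 1 by simp
  moreover have "(2::real) ^ fact m * (2 / 2 ^ fact (Suc m)) \<le> Q powr (\<theta> - 1 / real k)"
  proof -
    have "(2::real) ^ fact m * (2 / 2 ^ fact (Suc m))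
        = exp (ln 2 * fact m) * (exp (ln 2) / exp (ln 2 * fact (Suc m)))"
      by (simp only: e of_nat_fact) simp
    also have "\<dots> = exp (ln 2 * fact m + ln 2 - ln 2 * fact (Suc m))"
      by (simp only: exp_add exp_diff times_divide_eq_right)
    finally show ?thesis
      unfolding p using 2 by simp
  qed
  ultimately show ?thesis
    using order_trans[OF fact_vec_error] unfolding sol_set_def mem_Collect_eq
    by (intro conjI ballI) (auto simp: int_vec_def fact_vec_def)
qed

section \<open>Estimates for the minima within one window of \<open>Q\<close>\<close>

lemma psi_fact_zeta_estimates:
  fixes m k :: nat and Q :: real
  defines "t \<equiv> ln 2 * fact (Suc m) / ln Q"
  assumes k: "k \<ge> 2" and m: "m \<ge> 1" and Q: "Q > 1"
    and lower: "ln 2 * fact (Suc m) \<le> (1 + 1 / real k) * ln Q"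
    and upper: "(1 + 1 / real k) * ln Q \<le> ln 2 * fact (Suc (Suc m))"
  shows "\<bar>psi k (fact_zeta k) 1 Q - min (1 / real k - t) (t - 1)\<bar> \<le> 12 / real (Suc m)"
    and "\<bar>psi k (fact_zeta k) 2 Q - max (1 / real k - t) (t - 1)\<bar> \<le> 12 / real (Suc m)"
    and "psi k (fact_zeta k) 2 Q \<le> 1 / real k"
    and "\<And>j. j \<in> {3..k + 1} \<Longrightarrow> \<bar>psi k (fact_zeta k) j Q - 1 / real k\<bar> \<le> 12 / real (Suc m)"
proof -
  define a where "a = 1 / real k"
  define q where "q = ln Q"
  define p where "p = ln 2 * fact m / q"
  define r where "r = ln 2 / q"
  have q: "q > 0"
    using Q by (simp add: q_def)
  have a: "0 < a" "a \<le> 1"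
    using k by (auto simp: a_def)
  have pr: "0 \<le> p" "0 \<le> r"
    using q by (auto simp: p_def r_def)
  have tq: "t * q = ln 2 * fact (Suc m)" and pq: "p * q = ln 2 * fact m" and rq: "r * q = ln 2"
    using q by (auto simp: t_def p_def r_def q_def)
  \<comment> \<open>The largest loss below is \<open>p + 5 * r\<close>, where
    \<open>\<alpha> + \<beta> = a - 1 + p + 2 * r\<close> and \<open>ln 6 / ln Q\<close> costs at
    most \<open>3 * r\<close>. Since \<open>r \<le> p\<close> it is at most \<open>6 * p\<close>,
    and \<open>p \<le> 2 / Suc m\<close> because \<open>ln 2 * fact (Suc m)\<close> is
    \<open>Suc m\<close> times \<open>p * q\<close> and at most \<open>2 * q\<close>.\<close>
  have err: "p + 5 * r \<le> 12 / real (Suc m)"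
  proof -
    have "r \<le> p"
      using q by (simp add: p_def r_def divide_right_mono)
    have "real (Suc m) * (p * q) = ln 2 * fact (Suc m)"
      unfolding pq by simp
    also have "\<dots> \<le> (1 + a) * q"
      using lower by (simp only: a_def q_def)
    also have "\<dots> \<le> 2 * q"
      using a q by (intro mult_right_mono) auto
    finally have "real (Suc m) * p \<le> 2"
      using q by (simp add: mult.assoc[symmetric])
    then have "p \<le> 2 / real (Suc m)"
      by (simp add: field_simps)
    then show ?thesis
      using \<open>r \<le> p\<close> by simp
  qed
  have ln6: "ln 6 / ln Q \<le> 3 * r"
  proof -
    have "ln (6::real) \<le> ln (2 ^ 3)"
      by (subst ln_le_cancel_iff) auto
    also have "\<dots> = 3 * ln 2"
      by (subst ln_realpow) auto
    finally show ?thesis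
      using q by (simp add: r_def q_def divide_right_mono)
  qed
  \<comment> \<open>For the vector at \<open>m\<close> the error condition fixes
    \<open>\<alpha>\<close>, and \<open>lower\<close> leaves room in the size condition. For the one
    at \<open>Suc m\<close> the size condition suggests \<open>\<beta>\<close>, and
    \<open>upper\<close> takes care of the error.\<close>
  define \<alpha> where "\<alpha> = a - t + p + r"
  define \<beta> where "\<beta> = t - 1 + r"
  have x: "fact_vec k m \<in> sol_set k (fact_zeta k) Q \<alpha>"
  proof (rule fact_vec_in_sol_set[OF Q])
    have "t * q \<le> (1 + a) * q"
      using lower tq by (simp add: a_def q_def)
    then have "t \<le> 1 + a"
      using q by simp
    then have "p * q \<le> (1 + \<alpha>) * q"
      using q pr by (intro mult_right_mono) (auto simp: \<alpha>_def)
    then show "ln 2 * fact m \<le> (1 + \<alpha>) * ln Q"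
      by (simp only: pq flip: q_def)
    have "ln 2 * fact m + ln 2 - ln 2 * fact (Suc m) = (p + r - t) * q"
      by (simp only: tq pq rq left_diff_distrib distrib_right)
    also have "\<dots> = (\<alpha> - 1 / real k) * ln Q"
      by (simp add: \<alpha>_def a_def q_def)
    finally show "ln 2 * fact m + ln 2 - ln 2 * fact (Suc m) \<le> (\<alpha> - 1 / real k) * ln Q"
      by simp
  qed
  have y: "fact_vec k (Suc m) \<in> sol_set k (fact_zeta k) Q \<beta>"
  proof (rule fact_vec_in_sol_set[OF Q])
    have "t * q \<le> (1 + \<beta>) * q"
      using q pr by (intro mult_right_mono) (auto simp: \<beta>_def)
    then show "ln 2 * fact (Suc m) \<le> (1 + \<beta>) * ln Q"
      by (simp only: tq flip: q_def)
    have "ln 2 * fact (Suc m) + ln 2 - ln 2 * fact (Suc (Suc m)) \<le> t * q + r * q - (1 + a) * q"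
      using upper unfolding tq rq unfolding a_def q_def by linarith
    also have "\<dots> = (\<beta> - 1 / real k) * ln Q"
      by (simp add: \<beta>_def a_def q_def algebra_simps)
    finally show "ln 2 * fact (Suc m) + ln 2 - ln 2 * fact (Suc (Suc m)) \<le> (\<beta> - 1 / real k) * ln Q" .
  qed
  have nz: "fact_vec k m 0 \<noteq> 0" "fact_vec k (Suc m) 0 \<noteq> 0"
    by (simp_all add: fact_vec_0)
  have c: "m mod k + 1 \<in> {1..k}"
    using k by (simp add: Suc_leI)
  have D: "fact_vec k m 0 * fact_vec k (Suc m) (m mod k + 1) \<noteq>
      fact_vec k (Suc m) 0 * fact_vec k m (m mod k + 1)"
    using k by (intro fact_vec_minor) auto
  have z: "\<forall>i\<in>{1..k}. \<bar>fact_zeta k i\<bar> \<le> 1"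
    using abs_fact_zeta_le_1 by blast
  have r: "ln 2 / ln Q = r"
    by (simp add: r_def q_def)
  note P1 = psi_1_bounds[OF Q x y nz c D, unfolded r, folded a_def]
  note P2 = psi_2_bounds[OF Q x y nz c D z, unfolded r, folded a_def]
  note P3 = psi_ge_3_bounds[OF Q x y c D z, folded a_def]
  define lo where "lo = min (a - t) (t - 1)"
  define hi where "hi = max (a - t) (t - 1)"
  \<comment> \<open>The constant sum turns the lower bounds, which subtract the other exponent from
    \<open>a - 1\<close>, into bounds by \<open>lo\<close> and \<open>hi\<close> themselves.\<close>
  have lohi: "lo + hi = a - 1"
    by (simp add: lo_def hi_def min_def max_def)
  have mn: "min \<alpha> \<beta> \<le> lo + p + r" and mx: "max \<alpha> \<beta> \<le> hi + p + r"
    using pr by (auto simp: \<alpha>_def \<beta>_def lo_def hi_def min_def max_def)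
  show "\<bar>psi k (fact_zeta k) 1 Q - min (1 / real k - t) (t - 1)\<bar> \<le> 12 / real (Suc m)"
    unfolding a_def[symmetric] lo_def[symmetric] abs_le_iff
    using order_trans[OF P1(2) mn] P1(1) mx lohi err pr by linarith
  show "\<bar>psi k (fact_zeta k) 2 Q - max (1 / real k - t) (t - 1)\<bar> \<le> 12 / real (Suc m)"
    unfolding a_def[symmetric] hi_def[symmetric] abs_le_iff
    using order_trans[OF P2(2) mx] P2(1) mn lohi err pr by linarith
  show "psi k (fact_zeta k) 2 Q \<le> 1 / real k"
    using P2(3) by (simp add: a_def)
  show "\<bar>psi k (fact_zeta k) j Q - 1 / real k\<bar> \<le> 12 / real (Suc m)" if "j \<in> {3..k + 1}" for j
  proof -
    have "2 / real k = 2 * a"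
      by (simp add: a_def)
    then show ?thesis
      using P3[OF that] err pr ln6 unfolding a_def[symmetric] \<alpha>_def \<beta>_def by auto
  qed
qed

section \<open>Covering all large \<open>Q\<close> by windows, and test points inside them\<close>

definition fact_window :: "nat \<Rightarrow> nat \<Rightarrow> real \<Rightarrow> bool" where
  "fact_window k m Q \<longleftrightarrow> Q > 1 \<and> ln 2 * fact (Suc m) \<le> (1 + 1 / real k) * ln Q \<and>
     (1 + 1 / real k) * ln Q \<le> ln 2 * fact (Suc (Suc m))"

lemma real_le_fact: "real n \<le> fact n"
  using fact_ge_self[of n] by (metis of_nat_fact of_nat_le_iff)

text \<open>Consecutive windows share an endpoint, so every large \<open>Q\<close> lies in one, and
  its index can be forced to be as large as desired.\<close>

lemma eventually_fact_window:
  assumes "\<epsilon> > 0"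
  shows "eventually (\<lambda>Q. \<exists>m\<ge>1. 12 / real (Suc m) \<le> \<epsilon> \<and> fact_window k m Q) at_top"
proof -
  obtain M0 :: nat where M0: "12 / \<epsilon> < real M0"
    using reals_Archimedean2 by blast
  define M where "M = max 1 M0"
  have "\<exists>m\<ge>1. 12 / real (Suc m) \<le> \<epsilon> \<and> fact_window k m Q"
    if Q: "Q \<ge> max 2 (exp (ln 2 * fact (Suc M)))" for Q
  proof -
    define y where "y = (1 + 1 / real k) * ln Q"
    have "exp (ln 2 * fact (Suc M)) \<le> Q"
      using Q by simp
    then have "ln 2 * fact (Suc M) \<le> ln Q"
      using Q by (subst ln_ge_iff) auto
    also have "\<dots> \<le> y"
    proof -
      have "1 * ln Q \<le> (1 + 1 / real k) * ln Q"
        using Q by (intro mult_right_mono) auto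
      then show ?thesis
        by (simp add: y_def)
    qed
    finally have yM: "ln 2 * fact (Suc M) \<le> y" .
    obtain N :: nat where "y / ln 2 < real N"
      using reals_Archimedean2 by blast
    also have "real N \<le> real (Suc (M + N))"
      by simp
    also have "\<dots> \<le> fact (Suc (M + N))"
      by (rule real_le_fact)
    finally have N: "y < ln 2 * fact (Suc (M + N))"
      by (simp add: pos_divide_less_eq mult.commute del: fact_Suc)
    \<comment> \<open>The first factorial level above \<open>y\<close>. It is not the starting
      level, by \<open>yM\<close>, so the level before it is the lower end of the window.\<close>
    define n where "n = (LEAST n. y < ln 2 * fact (Suc (M + n)))"
    have n: "y < ln 2 * fact (Suc (M + n))"
      unfolding n_def using N by (rule LeastI[of "\<lambda>n. y < ln 2 * fact (Suc (M + n))"])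
    have "n \<noteq> 0"
      using n yM by (metis add_0_right not_less)
    then obtain l where l: "n = Suc l"
      using not0_implies_Suc by blast
    have "\<not> y < ln 2 * fact (Suc (M + l))"
      using not_less_Least[of l "\<lambda>n. y < ln 2 * fact (Suc (M + n))"] l by (simp only: n_def) blast
    then have "fact_window k (M + l) Q"
      using n Q by (simp add: fact_window_def y_def l del: fact_Suc)
    moreover have "12 / real (Suc (M + l)) \<le> \<epsilon>"
    proof -
      have "real M0 \<le> real (Suc (M + l))"
        by (simp add: M_def)
      then have "12 / \<epsilon> \<le> real (Suc (M + l))"
        using M0 by linarith
      then show ?thesis
        using assms by (simp add: field_simps)
    qed
    ultimately show ?thesis
      by (intro exI[of _ "M + l"]) (auto simp: M_def)
  qed
  then show ?thesis
    unfolding eventually_at_top_linorder by blast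
qed

text \<open>The \<open>Q\<close> in window \<open>Suc n\<close> whose parameter \<open>t\<close>
  equals \<open>(1 + 1 / k) / c\<close>. The shift makes the window index at least 1;
  \<open>c = 1\<close> is the left end of the window.\<close>

definition window_point :: "nat \<Rightarrow> real \<Rightarrow> nat \<Rightarrow> real" where
  "window_point k c n = exp (c * (ln 2 * fact (Suc (Suc n))) / (1 + 1 / real k))"

lemma one_plus_inverse_pos: "0 < 1 + 1 / real k"
  by (simp add: add_pos_nonneg)

lemma filterlim_window_point:
  assumes "c > 0"
  shows "filterlim (window_point k c) at_top sequentially"
proof -
  have "filterlim (\<lambda>n. fact (Suc (Suc n)) :: real) at_top sequentially"
  proof (rule filterlim_at_top_mono[OF filterlim_real_sequentially], intro always_eventually allI)
    fix n
    show "real n \<le> fact (Suc (Suc n))"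
      using real_le_fact[of "Suc (Suc n)"] by linarith
  qed
  then have "filterlim (\<lambda>n. c * ln 2 / (1 + 1 / real k) * fact (Suc (Suc n))) at_top sequentially"
    using assms one_plus_inverse_pos[of k]
    by (intro filterlim_tendsto_pos_mult_at_top[OF tendsto_const]) auto
  then have "filterlim (\<lambda>n. exp (c * ln 2 / (1 + 1 / real k) * fact (Suc (Suc n)))) at_top sequentially"
    by (rule filterlim_compose[OF exp_at_top])
  then show ?thesis
    unfolding window_point_def by (simp only: times_divide_eq_left mult.assoc)
qed

lemma fact_window_point:
  assumes "1 \<le> c" "c \<le> 2"
  shows "fact_window k (Suc n) (window_point k c n)"
    and "ln 2 * fact (Suc (Suc n)) / ln (window_point k c n) = (1 + 1 / real k) / c"
proof -
  define F where "F = ln 2 * (fact (Suc (Suc n)) :: real)"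
  have F: "F > 0"
    by (simp add: F_def del: fact_Suc)
  note d = one_plus_inverse_pos[of k]
  have l: "ln (window_point k c n) = c * F / (1 + 1 / real k)"
    by (simp add: window_point_def F_def del: fact_Suc)
  \<comment> \<open>The next factorial is at least twice as large, so \<open>c \<le> 2\<close> stays
    inside the window.\<close>
  have "2 * F \<le> real (Suc (Suc (Suc n))) * F"
    using F by (intro mult_right_mono) auto
  also have "\<dots> = ln 2 * fact (Suc (Suc (Suc n)))"
    by (simp add: F_def fact_Suc[of "Suc (Suc n)"] del: fact_Suc)
  finally have "2 * F \<le> ln 2 * fact (Suc (Suc (Suc n)))" .
  moreover have "F \<le> c * F" "c * F \<le> 2 * F"
    using assms F by auto
  moreover have "(1 + 1 / real k) * ln (window_point k c n) = c * F"
    using d unfolding l by simp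
  moreover have "window_point k c n > 1"
    using F assms d unfolding window_point_def F_def[symmetric] by simp
  ultimately show "fact_window k (Suc n) (window_point k c n)"
    unfolding fact_window_def F_def by linarith
  show "ln 2 * fact (Suc (Suc n)) / ln (window_point k c n) = (1 + 1 / real k) / c"
    using F assms d unfolding l F_def[symmetric] by (simp add: field_simps)
qed

lemma tendsto_window_point:
  assumes "1 \<le> c" "c \<le> 2"
    and est: "\<And>m Q. m \<ge> 1 \<Longrightarrow> fact_window k m Q \<Longrightarrow>
      \<bar>f Q - g (ln 2 * fact (Suc m) / ln Q)\<bar> \<le> 12 / real (Suc m)"
  shows "(\<lambda>n. f (window_point k c n)) \<longlonglongrightarrow> g ((1 + 1 / real k) / c)"
proof (rule LIM_zero_cancel, rule Lim_null_comparison)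
  show "(\<lambda>n. 12 / real (Suc (Suc n))) \<longlonglongrightarrow> 0"
    by (rule LIMSEQ_Suc[OF LIMSEQ_Suc[OF lim_const_over_n]])
  show "\<forall>\<^sub>F n in sequentially. norm (f (window_point k c n) - g ((1 + 1 / real k) / c))
      \<le> 12 / real (Suc (Suc n))"
    using est[OF _ fact_window_point(1)[OF assms(1,2)]] fact_window_point(2)[OF assms(1,2)]
    by (intro always_eventually allI) (simp del: fact_Suc)
qed

text \<open>\<open>g\<close> is the limiting profile of \<open>f\<close> as a function of
  \<open>t\<close>; its value at \<open>(1 + 1 / k) / c\<close> is approached along the window
  points.\<close>

lemma Limsup_window_eqI:
  assumes c: "1 \<le> c" "c \<le> 2"
    and est: "\<And>m Q. m \<ge> 1 \<Longrightarrow> fact_window k m Q \<Longrightarrow>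
      \<bar>f Q - g (ln 2 * fact (Suc m) / ln Q)\<bar> \<le> 12 / real (Suc m)"
    and L: "g ((1 + 1 / real k) / c) = L"
    and up: "\<And>m Q. m \<ge> 1 \<Longrightarrow> fact_window k m Q \<Longrightarrow> f Q \<le> L + 12 / real (Suc m)"
  shows "Limsup at_top (\<lambda>Q. ereal (f Q)) = ereal L"
proof (rule Limsup_at_top_eqI)
  show "\<forall>\<^sub>F Q in at_top. f Q \<le> L + \<epsilon>" if "\<epsilon> > 0" for \<epsilon>
    using eventually_fact_window[OF that, of k]
  proof eventually_elim
    case (elim Q)
    then obtain m where "m \<ge> 1" "12 / real (Suc m) \<le> \<epsilon>" "fact_window k m Q"
      by blast
    then show ?case
      using up[of m Q] by linarith
  qed
  show "filterlim (window_point k c) at_top sequentially"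
    using c by (intro filterlim_window_point) auto
  show "(\<lambda>n. f (window_point k c n)) \<longlonglongrightarrow> L"
    unfolding L[symmetric] by (rule tendsto_window_point[OF c est])
qed

lemma Liminf_window_eqI:
  assumes c: "1 \<le> c" "c \<le> 2"
    and est: "\<And>m Q. m \<ge> 1 \<Longrightarrow> fact_window k m Q \<Longrightarrow>
      \<bar>f Q - g (ln 2 * fact (Suc m) / ln Q)\<bar> \<le> 12 / real (Suc m)"
    and L: "g ((1 + 1 / real k) / c) = L"
    and low: "\<And>m Q. m \<ge> 1 \<Longrightarrow> fact_window k m Q \<Longrightarrow> L - 12 / real (Suc m) \<le> f Q"
  shows "Liminf at_top (\<lambda>Q. ereal (f Q)) = ereal L"
proof (rule Liminf_at_top_eqI)
  show "\<forall>\<^sub>F Q in at_top. L - \<epsilon> \<le> f Q" if "\<epsilon> > 0" for \<epsilon>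
    using eventually_fact_window[OF that, of k]
  proof eventually_elim
    case (elim Q)
    then obtain m where "m \<ge> 1" "12 / real (Suc m) \<le> \<epsilon>" "fact_window k m Q"
      by blast
    then show ?case
      using low[of m Q] by linarith
  qed
  show "filterlim (window_point k c) at_top sequentially"
    using c by (intro filterlim_window_point) auto
  show "(\<lambda>n. f (window_point k c n)) \<longlonglongrightarrow> L"
    unfolding L[symmetric] by (rule tendsto_window_point[OF c est])
qed

section \<open>The limits of the minima\<close>

lemma psi_fact_zeta_limits:
  assumes k: "k \<ge> 2"
  shows "psi_lower k (fact_zeta k) 1 = ereal (- 1)"
    and "psi_upper k (fact_zeta k) 1 = ereal ((1 - real k) / (2 * real k))"
    and "psi_lower k (fact_zeta k) 2 = ereal ((1 - real k) / (2 * real k))"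
    and "psi_upper k (fact_zeta k) 2 = ereal (1 / real k)"
    and "\<And>j. j \<in> {3..k + 1} \<Longrightarrow> psi_lower k (fact_zeta k) j = ereal (1 / real k)"
    and "\<And>j. j \<in> {3..k + 1} \<Longrightarrow> psi_upper k (fact_zeta k) j = ereal (1 / real k)"
proof -
  define a where "a = 1 / real k"
  have a: "0 < a"
    using k by (simp add: a_def)
  have mid: "(1 - real k) / (2 * real k) = (a - 1) / 2"
    using k by (simp add: a_def field_simps)
  define g1 where "g1 t = min (a - t) (t - 1)" for t
  define g2 where "g2 t = max (a - t) (t - 1)" for t
  define T where "T m Q = ln 2 * fact (Suc m) / ln Q" for m and Q :: real
  \<comment> \<open>The lines \<open>a - t\<close> and \<open>t - 1\<close> have constant sum
    \<open>a - 1\<close>, so their minimum is at most half of it and their maximum at least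
    half.\<close>
  have g1_le: "g1 t \<le> (a - 1) / 2" and g2_ge: "(a - 1) / 2 \<le> g2 t" for t
    by (auto simp: g1_def g2_def min_def max_def)
  have g1_ge: "- 1 \<le> g1 t" if "0 \<le> t" "t \<le> 1 + a" for t
    using that by (simp add: g1_def)
  note wd = fact_window_def[of k]
  have T: "0 \<le> T m Q" "T m Q \<le> 1 + a" if "fact_window k m Q" for m Q
    using that by (auto simp: wd T_def a_def pos_divide_le_eq simp del: fact_Suc)
  have E1: "\<bar>psi k (fact_zeta k) 1 Q - g1 (ln 2 * fact (Suc m) / ln Q)\<bar> \<le> 12 / real (Suc m)"
    if "m \<ge> 1" "fact_window k m Q" for m Q
    using psi_fact_zeta_estimates(1)[OF k that(1)] that(2) unfolding wd g1_def a_def by blast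
  have E2: "\<bar>psi k (fact_zeta k) 2 Q - g2 (ln 2 * fact (Suc m) / ln Q)\<bar> \<le> 12 / real (Suc m)"
    if "m \<ge> 1" "fact_window k m Q" for m Q
    using psi_fact_zeta_estimates(2)[OF k that(1)] that(2) unfolding wd g2_def a_def by blast
  have E3: "\<bar>psi k (fact_zeta k) j Q - a\<bar> \<le> 12 / real (Suc m)"
    if "m \<ge> 1" "fact_window k m Q" "j \<in> {3..k + 1}" for m Q j
    using psi_fact_zeta_estimates(4)[OF k that(1) _ _ _ that(3)] that(2) unfolding wd a_def by blast
  have U2: "psi k (fact_zeta k) 2 Q \<le> a" if "m \<ge> 1" "fact_window k m Q" for m Q
    using psi_fact_zeta_estimates(3)[OF k that(1)] that(2) unfolding wd a_def by blast
  show "psi_lower k (fact_zeta k) 1 = ereal (- 1)"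
    unfolding psi_lower_def
  proof (rule Liminf_window_eqI[of 1, OF _ _ E1])
    \<comment> \<open>At the left end of a window \<open>t = 1 + a\<close>, where
      \<open>a - t = - 1\<close>.\<close>
    show "g1 ((1 + 1 / real k) / 1) = - 1"
      using a by (simp add: g1_def a_def[symmetric])
    show "- 1 - 12 / real (Suc m) \<le> psi k (fact_zeta k) 1 Q" if "m \<ge> 1" "fact_window k m Q" for m Q
      using E1[OF that] g1_ge[OF T[OF that(2)]] unfolding T_def by linarith
  qed auto
  show "psi_upper k (fact_zeta k) 1 = ereal ((1 - real k) / (2 * real k))"
    unfolding psi_upper_def mid
  proof (rule Limsup_window_eqI[of 2, OF _ _ E1])
    \<comment> \<open>\<open>c = 2\<close> gives the crossing point \<open>t = (1 + a) / 2\<close>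
      of the two lines.\<close>
    show "g1 ((1 + 1 / real k) / 2) = (a - 1) / 2"
      by (simp add: g1_def a_def[symmetric] min_def field_simps)
    show "psi k (fact_zeta k) 1 Q \<le> (a - 1) / 2 + 12 / real (Suc m)"
      if "m \<ge> 1" "fact_window k m Q" for m Q
      using E1[OF that] g1_le[of "ln 2 * fact (Suc m) / ln Q"] by linarith
  qed auto
  show "psi_lower k (fact_zeta k) 2 = ereal ((1 - real k) / (2 * real k))"
    unfolding psi_lower_def mid
  proof (rule Liminf_window_eqI[of 2, OF _ _ E2])
    show "g2 ((1 + 1 / real k) / 2) = (a - 1) / 2"
      by (simp add: g2_def a_def[symmetric] max_def field_simps)
    show "(a - 1) / 2 - 12 / real (Suc m) \<le> psi k (fact_zeta k) 2 Q"
      if "m \<ge> 1" "fact_window k m Q" for m Q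
      using E2[OF that] g2_ge[of "ln 2 * fact (Suc m) / ln Q"] by linarith
  qed auto
  show "psi_upper k (fact_zeta k) 2 = ereal (1 / real k)"
    unfolding psi_upper_def a_def[symmetric]
  proof (rule Limsup_window_eqI[of 1, OF _ _ E2])
    show "g2 ((1 + 1 / real k) / 1) = a"
      using a by (simp add: g2_def a_def[symmetric])
    show "psi k (fact_zeta k) 2 Q \<le> a + 12 / real (Suc m)" if "m \<ge> 1" "fact_window k m Q" for m Q
      using U2[OF that] by (simp add: add_increasing2)
  qed auto
  show "psi_lower k (fact_zeta k) j = ereal (1 / real k)" if j: "j \<in> {3..k + 1}" for j
    unfolding psi_lower_def a_def[symmetric]
  proof (rule Liminf_window_eqI[of 1 _ _ "\<lambda>_. a", OF _ _ E3[OF _ _ j]])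
    show "a - 12 / real (Suc m) \<le> psi k (fact_zeta k) j Q" if "m \<ge> 1" "fact_window k m Q" for m Q
      using E3[OF that j] by linarith
  qed auto
  show "psi_upper k (fact_zeta k) j = ereal (1 / real k)" if j: "j \<in> {3..k + 1}" for j
    unfolding psi_upper_def a_def[symmetric]
  proof (rule Limsup_window_eqI[of 1 _ _ "\<lambda>_. a", OF _ _ E3[OF _ _ j]])
    show "psi k (fact_zeta k) j Q \<le> a + 12 / real (Suc m)" if "m \<ge> 1" "fact_window k m Q" for m Q
      using E3[OF that j] by linarith
  qed auto
qed

section \<open>Linear independence over the rationals\<close>

text \<open>The series use disjoint residue classes modulo \<open>k\<close>, so index
  \<open>M * k + j\<close> occurs in series \<open>j\<close> only.\<close>

lemma sum_mult_fact_term: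
  assumes j: "j \<in> {1..k}"
  shows "(\<Sum>i=1..k. f i * fact_term k i (M * k + j)) = f j / 2 ^ fact (M * k + j)"
proof -
  have "f i * fact_term k i (M * k + j) = (if i = j then f j / 2 ^ fact (M * k + j) else 0)"
    if i: "i \<in> {1..k}" for i
  proof (cases "i = j")
    case True
    have "M * k + j \<in> range (\<lambda>n. n * k + j)"
      by blast
    then show ?thesis
      using True by (simp add: fact_term_def)
  next
    case False
    have "M * k + j \<notin> range (\<lambda>n. n * k + i)"
    proof
      assume "M * k + j \<in> range (\<lambda>n. n * k + i)"
      then obtain n where n: "M * k + j = n * k + i"
        by blast
      \<comment> \<open>Subtracting 1 moves the labels \<open>1..k\<close> to \<open>0..k-1\<close>,
        where residues modulo \<open>k\<close> tell them apart.\<close>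
      have "M * k + (j - 1) = n * k + (i - 1)"
        using n i j by auto
      then have "(M * k + (j - 1)) mod k = (n * k + (i - 1)) mod k"
        by simp
      then have "j - 1 = i - 1"
        using i j by (simp add: less_eq_Suc_le)
      then show False
        using False i j by auto
    qed
    then show ?thesis
      using False by (simp add: fact_term_def)
  qed
  then have "(\<Sum>i=1..k. f i * fact_term k i (M * k + j))
      = (\<Sum>i=1..k. if i = j then f j / 2 ^ fact (M * k + j) else 0)"
    by (rule sum.cong[OF refl])
  then show ?thesis
    using j by simp
qed

lemma fact_zeta_int_independent:
  fixes a0 :: int and a :: "nat \<Rightarrow> int"
  assumes k: "k \<ge> 1" and rel: "of_int a0 + (\<Sum>j=1..k. of_int (a j) * fact_zeta k j) = 0"
  shows "a0 = 0 \<and> (\<forall>j\<in>{1..k}. a j = 0)"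
proof -
  \<comment> \<open>\<open>R m\<close> combines the tails after index \<open>m\<close>. By the
    relation, \<open>2 ^ fact m * R m\<close> is an integer, while the tails make it tend to
    0.\<close>
  define R where "R m = (\<Sum>j=1..k. of_int (a j) * (fact_zeta k j - (\<Sum>l\<le>m. fact_term k j l)))" for m
  define A where "A = (\<Sum>j=1..k. \<bar>real_of_int (a j)\<bar>)"
  have R_int: "2 ^ fact m * R m = of_int (- a0 * 2 ^ fact m - (\<Sum>j=1..k. a j * fact_vec k m j))" for m
  proof -
    have "2 ^ fact m * R m = 2 ^ fact m * (\<Sum>j=1..k. of_int (a j) * fact_zeta k j)
        - (\<Sum>j=1..k. of_int (a j) * (2 ^ fact m * (\<Sum>l\<le>m. fact_term k j l)))"
      unfolding R_def sum_distrib_left[of "2 ^ fact m" _ "{1..k}"] sum_subtractf[symmetric]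
      by (simp only: right_diff_distrib mult.left_commute)
    also have "(\<Sum>j=1..k. of_int (a j) * fact_zeta k j) = - of_int a0"
      using rel by linarith
    also have "(\<Sum>j=1..k. of_int (a j) * (2 ^ fact m * (\<Sum>l\<le>m. fact_term k j l)))
        = (\<Sum>j=1..k. of_int (a j) * of_int (fact_vec k m j))"
      by (rule sum.cong) (simp_all add: real_fact_vec)
    finally show ?thesis
      by simp
  qed
  have R_le: "\<bar>2 ^ fact m * R m\<bar> \<le> 2 * A * (1 / 2) ^ m" for m
  proof -
    have "\<bar>R m\<bar> \<le> (\<Sum>j=1..k. \<bar>real_of_int (a j)\<bar> * (2 / 2 ^ fact (Suc m)))"
      unfolding R_def
    proof (rule order_trans[OF sum_abs], rule sum_mono)
      fix j assume "j \<in> {1..k}"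
      show "\<bar>of_int (a j) * (fact_zeta k j - (\<Sum>l\<le>m. fact_term k j l))\<bar>
          \<le> \<bar>real_of_int (a j)\<bar> * (2 / 2 ^ fact (Suc m))"
        unfolding abs_mult using fact_zeta_tail[OF k, of j m] by (intro mult_left_mono) auto
    qed
    also have "\<dots> = A * (2 / 2 ^ fact (Suc m))"
      by (simp only: A_def sum_distrib_right)
    finally have "2 ^ fact m * \<bar>R m\<bar> \<le> 2 ^ fact m * (A * (2 / 2 ^ fact (Suc m)))"
      by (rule mult_left_mono) simp
    also have "\<dots> = 2 * A * (2 ^ fact m / 2 ^ fact (Suc m))"
      by (simp only: times_divide_eq_right mult_ac)
    also have "\<dots> \<le> 2 * A * (1 / 2) ^ m"
    proof (rule mult_left_mono)
      \<comment> \<open>The right side is \<open>fact (Suc m)\<close>, so the quotient of the two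
        powers is at most \<open>(1 / 2) ^ m\<close>.\<close>
      have "fact m + m * 1 \<le> (fact m + m * fact m :: nat)"
        by (intro add_left_mono mult_left_mono) auto
      then have "(2::real) ^ (fact m + m) \<le> 2 ^ fact (Suc m)"
        by (intro power_increasing) auto
      then show "(2::real) ^ fact m / 2 ^ fact (Suc m) \<le> (1 / 2) ^ m"
        by (simp add: field_simps power_add del: fact_Suc)
      show "0 \<le> 2 * A"
        unfolding A_def by (simp add: sum_nonneg)
    qed
    finally show ?thesis
      by (simp add: abs_mult)
  qed
  have "(\<lambda>m. 2 * A * (1 / 2) ^ m) \<longlonglongrightarrow> 2 * A * 0"
    by (intro tendsto_mult tendsto_const LIMSEQ_realpow_zero) auto
  then have "\<forall>\<^sub>F m in sequentially. 2 * A * (1 / 2) ^ m < 1"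
    by (rule order_tendstoD) simp
  then obtain M where M: "\<And>m. m \<ge> M \<Longrightarrow> 2 * A * (1 / 2) ^ m < 1"
    unfolding eventually_sequentially by blast
  have R0: "R m = 0" if "m \<ge> M" for m
  proof -
    obtain z :: int where z: "2 ^ fact m * R m = of_int z"
      using R_int by blast
    have "\<bar>real_of_int z\<bar> < 1"
      using R_le[of m] M[OF that] unfolding z by linarith
    then have "z = 0"
      by linarith
    then show ?thesis
      using z by simp
  qed
  have aj: "a j = 0" if j: "j \<in> {1..k}" for j
  proof -
    \<comment> \<open>\<open>Suc m\<close> is an index of series \<open>j\<close> beyond
      \<open>M\<close>. Passing from \<open>R m\<close> to \<open>R (Suc m)\<close> removes just the
      term of that series, with coefficient \<open>a j\<close>.\<close>
    define m where "m = M * k + j - 1"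
    have m: "Suc m = M * k + j"
      using j by (simp add: m_def)
    have "M * 1 \<le> M * k"
      using k by (intro mult_le_mono) auto
    then have "M \<le> m"
      using j m unfolding atLeastAtMost_iff by linarith
    then have "0 = R m - R (Suc m)"
      using R0 by simp
    also have "\<dots> = (\<Sum>i=1..k. of_int (a i) * fact_term k i (Suc m))"
      unfolding R_def sum_subtractf[symmetric] by (simp add: algebra_simps)
    also have "\<dots> = of_int (a j) / 2 ^ fact (M * k + j)"
      unfolding m by (rule sum_mult_fact_term[OF j])
    finally show ?thesis
      by simp
  qed
  then have "(\<Sum>j=1..k. of_int (a j) * fact_zeta k j) = 0"
    by (intro sum.neutral) simp
  then show ?thesis
    using rel aj by simp
qed

lemma ex_common_denominator:
  fixes c :: "nat \<Rightarrow> rat"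
  assumes "finite A"
  obtains D :: int and a where "D > 0" "\<And>j. j \<in> A \<Longrightarrow> of_int D * c j = of_int (a j)"
proof -
  have "\<exists>D::int. D > 0 \<and> (\<forall>j\<in>A. \<exists>n::int. of_int D * c j = of_int n)"
    using assms
  proof (induction A rule: finite_induct)
    case empty
    show ?case
      by (intro exI[of _ 1]) simp
  next
    case (insert x A)
    from insert.IH obtain D :: int
      where D: "D > 0" "\<forall>j\<in>A. \<exists>n::int. of_int D * c j = of_int n"
      by (elim exE conjE)
    obtain p q where pq: "c x = of_int p / of_int q" "q > 0"
      using quotient_of_div[OF prod.collapse[symmetric], of "c x"] quotient_of_denom_pos'[of "c x"]
      by (rule that)
    have "\<exists>n::int. of_int (D * q) * c j = of_int n" if "j \<in> insert x A" for j
    proof (cases "j = x")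
      case True
      have "of_int (D * q) * c j = of_int (D * p)"
        using True pq by simp
      then show ?thesis
        by (rule exI)
    next
      case False
      then have "j \<in> A"
        using that by simp
      with D(2) obtain n :: int where n: "of_int D * c j = of_int n"
        by blast
      have "of_int (D * q) * c j = of_int q * (of_int D * c j)"
        by (simp only: of_int_mult mult_ac)
      also have "\<dots> = of_int (q * n)"
        by (simp only: n of_int_mult)
      finally show ?thesis
        by (rule exI)
    qed
    then show ?case
      using mult_pos_pos[OF D(1) pq(2)] by (intro exI[of _ "D * q"]) blast
  qed
  then obtain D :: int where D: "D > 0" "\<forall>j\<in>A. \<exists>n::int. of_int D * c j = of_int n"
    by (elim exE conjE)
  have "\<exists>a::nat \<Rightarrow> int. \<forall>j\<in>A. of_int D * c j = of_int (a j)"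
    by (rule bchoice[OF D(2)])
  then obtain a :: "nat \<Rightarrow> int" where a: "\<forall>j\<in>A. of_int D * c j = of_int (a j)"
    by (elim exE)
  show ?thesis
    by (rule that[OF D(1)]) (rule bspec[OF a])
qed

lemma fact_zeta_rat_independent:
  fixes c0 :: rat and c :: "nat \<Rightarrow> rat"
  assumes k: "k \<ge> 1" and rel: "of_rat c0 + (\<Sum>j=1..k. of_rat (c j) * fact_zeta k j) = 0"
  shows "c0 = 0 \<and> (\<forall>j\<in>{1..k}. c j = 0)"
proof -
  \<comment> \<open>The constant \<open>c0\<close> takes slot 0, outside the summation range, so
    that one common denominator clears all coefficients.\<close>
  define d where "d = c(0 := c0)"
  obtain D :: int and a where D: "D > 0" and a: "\<And>j. j \<in> {0..k} \<Longrightarrow> of_int D * d j = of_int (a j)"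
    using ex_common_denominator[of "{0..k}" d] by auto
  have real_a: "real_of_int (a j) = of_int D * of_rat (d j)" if "j \<in> {0..k}" for j
    using arg_cong[OF a[OF that], of "of_rat :: rat \<Rightarrow> real"] by (simp add: of_rat_mult)
  have "of_int (a 0) + (\<Sum>j=1..k. of_int (a j) * fact_zeta k j)
      = of_int D * (of_rat c0 + (\<Sum>j=1..k. of_rat (c j) * fact_zeta k j))"
  proof -
    have "(\<Sum>j=1..k. of_int (a j) * fact_zeta k j)
        = (\<Sum>j=1..k. of_int D * (of_rat (c j) * fact_zeta k j))"
      by (rule sum.cong) (auto simp: real_a d_def)
    then show ?thesis
      by (simp add: real_a d_def distrib_left sum_distrib_left)
  qed
  also have "\<dots> = 0"
    using rel by simp
  finally have "a 0 = 0 \<and> (\<forall>j\<in>{1..k}. a j = 0)"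
    by (rule fact_zeta_int_independent[OF k])
  then have "a j = 0" if "j \<in> {0..k}" for j
    using that by (cases "j = 0") auto
  then have d0: "d j = 0" if "j \<in> {0..k}" for j
    using a[OF that] that D by simp
  have "c0 = 0"
    using d0[of 0] by (simp add: d_def)
  moreover have "c j = 0" if "j \<in> {1..k}" for j
    using d0[of j] that by (simp add: d_def)
  ultimately show ?thesis
    by blast
qed

section \<open>The double sequence \<open>q n j\<close> and its required properties\<close>

theorem theorem3p2:
  fixes k :: nat
  assumes "k \<ge> 2"
  shows "\<exists>q :: nat \<Rightarrow> nat \<Rightarrow> nat.
    (\<forall>n\<ge>1. \<forall>j\<in>{1..k}. q n j > 0) \<and>
    (\<forall>n\<ge>1. \<forall>j\<in>{1..<k}. q n j < q n (j+1) \<and> q n j dvd q n (j+1)) \<and>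
    (\<forall>n\<ge>1. q n k < q (n+1) 1 \<and> q n k dvd q (n+1) 1) \<and>
    (let b = (\<lambda>m::nat. ln (real (q ((m - 1) div k + 1) ((m - 1) mod k + 1))))
     in filterlim (\<lambda>m. b (m + 1) / b m) at_top sequentially) \<and>
    (let zeta = (\<lambda>j. \<Sum>n. 1 / real (q (n + 1) j)) in
      (\<forall>j\<in>{1..k}. summable (\<lambda>n. 1 / real (q (n + 1) j))) \<and>
      (\<forall>(c0::rat) (c::nat \<Rightarrow> rat).
         of_rat c0 + (\<Sum>j=1..k. of_rat (c j) * zeta j) = (0::real) \<longrightarrow>
         c0 = 0 \<and> (\<forall>j\<in>{1..k}. c j = 0)) \<and>
      psi_lower k zeta 1 = -1 \<and>
      (\<forall>j\<in>{1..k}. psi_lower k zeta (j + 1) = psi_upper k zeta j) \<and>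
      psi_upper k zeta 1 = ereal ((1 - real k) / (2 * real k)) \<and>
      psi_lower k zeta 2 = ereal ((1 - real k) / (2 * real k)) \<and>
      (\<forall>j\<in>{2..k}. psi_upper k zeta j = ereal (1 / real k) \<and>
                    psi_lower k zeta (j + 1) = ereal (1 / real k)) \<and>
      psi_upper k zeta (k + 1) = ereal (1 / real k))"
proof -
  \<comment> \<open>As \<open>n\<close> starts at 1, \<open>(n - 1) * k + j\<close> with
    \<open>1 \<le> j \<le> k\<close> runs through the positive integers once, in the order required
    of the \<open>q n j\<close>.\<close>
  define q :: "nat \<Rightarrow> nat \<Rightarrow> nat" where "q n j = 2 ^ fact ((n - 1) * k + j)" for n j
  have zeta: "(\<lambda>j. \<Sum>n. 1 / real (q (n + 1) j)) = fact_zeta k"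
    by (simp add: q_def fact_zeta_def fun_eq_iff)
  have step: "(2::nat) ^ fact l < 2 ^ fact (Suc l) \<and> (2::nat) ^ fact l dvd 2 ^ fact (Suc l)"
    if "l \<ge> 1" for l
  proof -
    have "fact l < (fact (Suc l) :: nat)"
      using that by (intro fact_less_mono_nat) auto
    then show ?thesis
      by (intro conjI power_strict_increasing le_imp_power_dvd) auto
  qed
  have q_step: "q n j < q n (j + 1) \<and> q n j dvd q n (j + 1)" if "j \<in> {1..<k}" for n j
    using step[of "(n - 1) * k + j"] that unfolding q_def by simp
  have q_next: "q n k < q (n + 1) 1 \<and> q n k dvd q (n + 1) 1" if "n \<ge> 1" for n
  proof -
    have "(n - 1) * k + k = n * k"
      using that by (cases n) auto
    then show ?thesis
      using step[of "n * k"] that assms unfolding q_def by simp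
  qed
  define b where "b = (\<lambda>m::nat. ln (real (q ((m - 1) div k + 1) ((m - 1) mod k + 1))))"
  have b: "b m = fact m * ln 2" if "m \<ge> 1" for m
  proof -
    have "((m - 1) div k + 1 - 1) * k + ((m - 1) mod k + 1) = m"
      using that by simp
    then show ?thesis
      by (simp only: b_def q_def) (simp add: ln_realpow)
  qed
  have b_lim: "filterlim (\<lambda>m. b (m + 1) / b m) at_top sequentially"
  proof (rule filterlim_at_top_mono[OF filterlim_real_sequentially])
    \<comment> \<open>For \<open>m \<ge> 1\<close> the quotient of the factorials is
      \<open>m + 1\<close>.\<close>
    show "\<forall>\<^sub>F m in sequentially. real m \<le> b (m + 1) / b m"
      using eventually_ge_at_top[of 1]
    proof eventually_elim
      case (elim m)
      then show ?case
        by (simp add: b field_simps)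
    qed
  qed
  note lim = psi_fact_zeta_limits[OF assms]
  have upper: "psi_upper k (fact_zeta k) j = ereal (1 / real k)" if "j \<in> {2..k + 1}" for j
    using that lim(4) lim(6)[of j] by (cases "j = 2") auto
  have lower: "psi_lower k (fact_zeta k) (j + 1) = ereal (1 / real k)" if "j \<in> {2..k}" for j
    using that by (intro lim(5)) auto
  have match: "psi_lower k (fact_zeta k) (j + 1) = psi_upper k (fact_zeta k) j" if "j \<in> {1..k}" for j
  proof (cases "j = 1")
    case True
    then show ?thesis
      using lim(2,3) by (simp only: one_add_one)
  next
    case False
    then show ?thesis
      using upper[of j] lower[of j] that by simp
  qed
  have summ: "summable (\<lambda>n. 1 / real (q (n + 1) j))" for j
    using summable_fact_zeta[of k j] assms by (simp add: q_def)
  have indep: "\<forall>(c0::rat) (c::nat \<Rightarrow> rat).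
         of_rat c0 + (\<Sum>j=1..k. of_rat (c j) * (\<Sum>n. 1 / real (q (n + 1) j))) = (0::real) \<longrightarrow>
         c0 = 0 \<and> (\<forall>j\<in>{1..k}. c j = 0)"
    unfolding fun_cong[OF zeta] using fact_zeta_rat_independent[of k] assms by simp
  have first: "psi_lower k (fact_zeta k) 1 = - 1"
    using lim(1) by (simp add: one_ereal_def)
  have last: "psi_upper k (fact_zeta k) (k + 1) = ereal (1 / real k)"
    using assms by (intro upper) auto
  show ?thesis
    unfolding Let_def
  proof (intro exI[of _ q], unfold zeta b_def[symmetric], intro conjI)
    show "\<forall>n\<ge>1. \<forall>j\<in>{1..k}. q n j > 0"
      by (simp add: q_def)
    show "\<forall>n\<ge>1. \<forall>j\<in>{1..<k}. q n j < q n (j+1) \<and> q n j dvd q n (j+1)"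
      using q_step by blast
    show "\<forall>n\<ge>1. q n k < q (n+1) 1 \<and> q n k dvd q (n+1) 1"
      using q_next by blast
    show "filterlim (\<lambda>m. ln (real (q ((m + 1 - 1) div k + 1) ((m + 1 - 1) mod k + 1)))
        / ln (real (q ((m - 1) div k + 1) ((m - 1) mod k + 1)))) at_top sequentially"
      using b_lim by (simp only: b_def)
    show "\<forall>j\<in>{1..k}. summable (\<lambda>n. 1 / real (q (n + 1) j))"
      using summ by blast
    show "\<forall>j\<in>{1..k}. psi_lower k (fact_zeta k) (j + 1) = psi_upper k (fact_zeta k) j"
      using match by blast
    show "\<forall>j\<in>{2..k}. psi_upper k (fact_zeta k) j = ereal (1 / real k) \<and>
        psi_lower k (fact_zeta k) (j + 1) = ereal (1 / real k)"
      using upper lower by simp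
  qed (fact indep first last lim(2,3))+
qed

end
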